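(* For every integer $n\geq 4$, the identity element $e$ is the only dominant vertex of $\Delta^o(S_n)$; that is, the set of dominant vertices of $\Delta^o(S_n)$ is $\{e\}$.
   Context: $S_n$ is the symmetric group of degree $n$. For a finite group $G$, $o(g)$ denotes the order of $g\in G$, and the order super commuting graph $\Delta^o(G)$ is the simple undirected graph with vertex set $G$ in which two distinct elements $g,h$ are adjacent iff either $o(g)=o(h)$, or there exist $g',h'\in G$ with $o(g')=o(g)$, $o(h')=o(h)$ such that $g'$ and $h'$ are distinct and commute. A vertex is dominant if it is adjacent to every other vertex. *)

theory Defs
  imports "HOL-Algebra.Sym_Groups" "HOL-Algebra.Multiplicative_Group"
    "Graph_Theory.Pair_Digraph"
begin

definition dominant_vertex :: "('a, 'b) pre_digraph \<Rightarrow> 'a \<Rightarrow> bool" where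
  "dominant_vertex D v \<longleftrightarrow>
     v \<in> verts D \<and> (\<forall>u \<in> verts D. u \<noteq> v \<longrightarrow> v \<rightarrow>\<^bsub>D\<^esub> u)"

text \<open>
  As in the Graph-Theory library, a simple undirected graph is a loop-free symmetric digraph
  without parallel arcs; see \<open>pair_graph_order_super_commuting_graph\<close> below.
  The definition is intended for finite groups: there, \<open>group.ord\<close> is the (positive) order of an
  element.
\<close>

definition order_super_commuting_graph ::
    "('a, 'b) monoid_scheme \<Rightarrow> 'a pair_pre_digraph" where
  "order_super_commuting_graph G =
     \<lparr> pverts = carrier G,
       parcs = {(g, h). g \<in> carrier G \<and> h \<in> carrier G \<and> g \<noteq> h \<and>
         (group.ord G g = group.ord G h \<or>
          (\<exists>g' \<in> carrier G. \<exists>h' \<in> carrier G.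
             group.ord G g' = group.ord G g \<and> group.ord G h' = group.ord G h \<and>
             g' \<noteq> h' \<and> g' \<otimes>\<^bsub>G\<^esub> h' = h' \<otimes>\<^bsub>G\<^esub> g'))} \<rparr>"

lemma pair_graph_order_super_commuting_graph:
  assumes "group G" "finite (carrier G)"
  shows "pair_graph (order_super_commuting_graph G)"
proof -
  let ?D = "order_super_commuting_graph G"
  have "parcs ?D \<subseteq> carrier G \<times> carrier G"
    by (auto simp: order_super_commuting_graph_def)
  then have fin: "finite (parcs ?D)"
    using assms(2) by (meson finite_SigmaI finite_subset)
  have sy: "sym (parcs ?D)"
  proof (rule symI)
    fix g h assume "(g, h) \<in> parcs ?D"
    then show "(h, g) \<in> parcs ?D"
      unfolding order_super_commuting_graph_def by simp metis
  qed
  show ?thesis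
    using fin sy assms(2)
    by unfold_locales (auto simp: symmetric_def order_super_commuting_graph_def)
qed

end

theory Submission
  imports Defs "HOL-Computational_Algebra.Primes"
begin

text \<open>
  Let \<open>v\<close> be a non-identity permutation and \<open>p\<close> a prime dividing its order. If \<open>A\<close> is a set of
  primes not containing \<open>p\<close> with \<open>n - p < \<Sum>A \<le> n\<close>, then a product \<open>u\<close> of disjoint cycles with
  lengths in \<open>A\<close> has order \<open>\<Prod>A\<close>. Were \<open>v\<close> adjacent to \<open>u\<close>, a permutation of order \<open>p\<close> would
  commute with one of order \<open>\<Prod>A\<close>, and their product would have order \<open>p * \<Prod>A\<close>; but such an order
  requires at least \<open>p + \<Sum>A > n\<close> points.

  The set \<open>A\<close> is found greedily, adding primes in increasing order: this works as soon as every
  prime is (essentially) at most the sum of the smaller ones. No form of Bertrand's postulate is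
  needed for that; Chebyshev's bound \<open>4 ^ m \<le> (2 * m) ^ (\<pi> (2 * m) + 1)\<close>, read off from the
  central binomial coefficient, already gives well over \<open>sqrt (2 * x)\<close> primes below a large \<open>x\<close>,
  and \<open>k\<close> distinct positive numbers sum to more than \<open>k\<^sup>2 / 2\<close>.
\<close>

section \<open>A lower bound for sums of primes\<close>

text \<open>This is Leibniz's harmonic triangle: with \<open>l n k = k * (n choose k)\<close> one has
  \<open>1 / l n (k + 1) = 1 / l (n - 1) k - 1 / l n k\<close>, so common multiples of the two terms on the
  right are multiples of \<open>l n (k + 1)\<close>.\<close>

lemma mult_binomial_dvd_common_multiple:
  fixes M :: nat
  assumes "k < n" and "\<And>i. \<lbrakk>1 \<le> i; i \<le> n\<rbrakk> \<Longrightarrow> i dvd M"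
  shows "Suc k * (n choose Suc k) dvd M"
  using assms
proof (induction k arbitrary: n)
  case 0
  then show ?case by simp
next
  case (Suc k)
  then obtain m where n: "n = Suc m" by (cases n) auto
  define X Y where "X = m choose k" and "Y = m choose Suc k"
  have "Suc m * X = Suc k * (Suc m choose Suc k)"
    by (simp only: X_def Suc_times_binomial_eq mult.commute)
  then have "Suc m * X dvd M"
    using Suc.IH[of n] Suc.prems by (simp add: n del: mult_Suc binomial_Suc_Suc)
  then obtain u where u: "int M = int (Suc m) * int X * int u"
    by (metis dvdE of_nat_mult)
  have "Suc k * Y dvd M"
    using Suc.IH[of m] Suc.prems by (simp add: n Y_def del: mult_Suc)
  then obtain v where v: "int M = int (Suc k) * int Y * int v"
    by (metis dvdE of_nat_mult)
  have "Suc k * (X + Y) = Suc m * X"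
    using Suc_times_binomial_eq[of m k] by (simp add: X_def Y_def algebra_simps)
  then have XY: "int (Suc k) * int Y = (int (Suc m) - int (Suc k)) * int X"
    by (simp add: algebra_simps flip: of_nat_mult of_nat_add)
  \<comment> \<open>The cofactor of \<open>Suc m * Y\<close> in \<open>M\<close> is
    \<open>v - u\<close>, hence the integers; \<open>Suc k\<close> cancels at the end.\<close>
  have "int (Suc k) * (int (Suc m) * int Y * (int v - int u))
      = int (Suc m) * (int (Suc k) * int Y * int v) - (int (Suc k) * int Y) * (int (Suc m) * int u)"
    by (simp only: algebra_simps)
  also have "\<dots> = int (Suc m) * int M - (int (Suc m) - int (Suc k)) * (int (Suc m) * int X * int u)"
    unfolding v[symmetric] unfolding XY by (simp only: algebra_simps)
  also have "\<dots> = int (Suc k) * int M"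
    unfolding u[symmetric] by (simp only: algebra_simps)
  finally have "int (Suc m) * int Y * (int v - int u) = int M"
    by (simp only: mult_cancel_left) simp
  then have "int (Suc m * Y) dvd int M"
    by (metis dvd_triv_left of_nat_mult)
  then have "Suc m * Y dvd M"
    by (simp only: of_nat_dvd_iff)
  then show ?case
    by (simp only: n Y_def Suc_times_binomial_eq mult.commute)
qed

lemma prime_power_dvd_Lcm_imp_dvd:
  fixes p :: nat
  assumes "finite A" "A \<noteq> {}" "0 \<notin> A" "prime p" "p ^ e dvd Lcm A"
  shows "\<exists>a\<in>A. p ^ e dvd a"
  using assms
proof (induction rule: finite_ne_induct)
  case (insert a A)
  have nz: "a \<noteq> 0" "Lcm A \<noteq> 0"
    using insert by (auto simp: Lcm_0_iff)
  have "e \<le> max (multiplicity p a) (multiplicity p (Lcm A))"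
    using insert.prems nz multiplicity_geI[where p = p and n = e and x = "lcm a (Lcm A)"]
    by (auto simp: multiplicity_lcm lcm_eq_0_iff prime_gt_Suc_0_nat[THEN less_imp_neq, symmetric])
  then consider "p ^ e dvd a" | "p ^ e dvd Lcm A"
    by (auto simp: le_max_iff_disj intro: multiplicity_dvd')
  then show ?case
    using insert by cases auto
qed auto

text \<open>The full power of a prime in the lcm divides a single number in \<open>{1..n}\<close>,
  so each factor of the prime factorization is at most \<open>n\<close>.\<close>

lemma Lcm_upto_le_power_card_primes:
  fixes n :: nat
  assumes "n \<ge> 1"
  shows "Lcm {1..n} \<le> n ^ card {p. prime p \<and> p \<le> n}"
proof -
  let ?L = "Lcm {1..n}"
  have nz: "?L \<noteq> 0" by (simp add: Lcm_0_iff)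
  have bound: "p ^ multiplicity p ?L \<le> n" if p: "prime p" for p
  proof -
    obtain a where "a \<in> {1..n}" "p ^ multiplicity p ?L dvd a"
      using prime_power_dvd_Lcm_imp_dvd[OF _ _ _ p multiplicity_dvd, of "{1..n}"] assms
      by auto
    then show ?thesis
      by (metis atLeastAtMost_iff dvd_imp_le le_trans less_le_trans zero_less_one)
  qed
  have sub: "prime_factors ?L \<subseteq> {p. prime p \<and> p \<le> n}"
  proof
    fix p assume p: "p \<in> prime_factors ?L"
    then have "prime p" "0 < multiplicity p ?L"
      by (auto simp: prime_factors_multiplicity)
    then have "p \<le> p ^ multiplicity p ?L"
      by (intro self_le_power prime_ge_1_nat)
    with p bound show "p \<in> {p. prime p \<and> p \<le> n}"
      using le_trans by blast
  qed
  have fin: "finite {p::nat. prime p \<and> p \<le> n}" by simp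
  have "?L = (\<Prod>p\<in>prime_factors ?L. p ^ multiplicity p ?L)"
    using nz[unfolded neq0_conv] by (rule prime_factorization_nat)
  also have "\<dots> \<le> (\<Prod>p\<in>prime_factors ?L. n)"
    using bound by (intro prod_mono) (auto dest: in_prime_factors_imp_prime)
  also have "\<dots> \<le> n ^ card {p. prime p \<and> p \<le> n}"
    using card_mono[OF fin sub] assms by (simp add: power_increasing)
  finally show ?thesis .
qed

text \<open>The central binomial coefficient divides the lcm and is at least
  \<open>4 ^ m / (2 * m)\<close>; the factor \<open>2 * m\<close> explains the \<open>Suc\<close> in
  the exponent.\<close>

lemma four_power_le_power_card_primes:
  fixes m :: nat
  assumes "m \<ge> 1"
  shows "4 ^ m \<le> (2 * m) ^ Suc (card {p. prime p \<and> p \<le> 2 * m})"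
proof -
  have "m * ((2 * m) choose m) dvd Lcm {1..2 * m}"
    using mult_binomial_dvd_common_multiple[of "m - 1" "2 * m" "Lcm {1..2 * m}"] assms by simp
  then have "(2 * m) choose m dvd Lcm {1..2 * m}"
    by (rule dvd_mult_right)
  then have "(2 * m) choose m \<le> Lcm {1..2 * m}"
    by (rule dvd_imp_le) (simp add: Lcm_0_iff flip: neq0_conv)
  also have "\<dots> \<le> (2 * m) ^ card {p. prime p \<and> p \<le> 2 * m}"
    using Lcm_upto_le_power_card_primes[of "2 * m"] assms by simp
  finally have *: "(2 * m) choose m \<le> (2 * m) ^ card {p. prime p \<and> p \<le> 2 * m}" .
  have "real (4 ^ m) \<le> real (2 * m * ((2 * m) choose m))"
    using central_binomial_lower_bound[of m] assms by (simp add: field_simps)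
  then have "4 ^ m \<le> 2 * m * ((2 * m) choose m)"
    by (simp only: of_nat_le_iff)
  also have "\<dots> \<le> 2 * m * (2 * m) ^ card {p. prime p \<and> p \<le> 2 * m}"
    using * by (rule mult_le_mono2)
  finally show ?thesis by simp
qed

text \<open>A new maximum \<open>b \<ge> card A + 2\<close> raises the right side by
  \<open>2 * b\<close>, the square only by \<open>2 * card A + 3\<close>.\<close>

lemma power2_Suc_card_le_sum:
  fixes A :: "nat set"
  assumes "finite A" "\<And>a. a \<in> A \<Longrightarrow> a \<ge> 2"
  shows "(Suc (card A))\<^sup>2 \<le> 2 * \<Sum>A + 1"
  using assms
proof (induction rule: finite_linorder_max_induct)
  case (insert b A)
  have "A \<subseteq> {2..<b}" using insert by auto
  from card_mono[OF _ this] have c: "card A + 2 \<le> b"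
    using insert.prems[of b] by simp
  have "b \<notin> A" using insert by auto
  with insert c show ?case by (auto simp: power2_eq_square)
qed simp

text \<open>The start is \<open>6 * 81 = 486 \<le> 512\<close>; this is why
  \<open>2 ^ 9 = 512\<close> separates small from large \<open>x\<close> below.\<close>

lemma six_mult_square_le_power2:
  fixes j :: nat
  assumes "j \<ge> 9"
  shows "6 * j\<^sup>2 \<le> 2 ^ j"
  using assms
proof (induction j rule: dec_induct)
  case (step j)
  have "9 * j \<le> j * j" using step by (intro mult_right_mono) auto
  moreover have "6 * (Suc j)\<^sup>2 = 6 * (j * j) + 12 * j + 6" by (simp add: power2_eq_square)
  ultimately have "6 * (Suc j)\<^sup>2 \<le> 2 * (6 * j\<^sup>2)"
    using step(1) unfolding power2_eq_square by linarith
  with step show ?case by simp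
qed simp

section \<open>Sums of all primes below a bound\<close>

definition primes_below :: "nat \<Rightarrow> nat set" where
  "primes_below x = {p. prime p \<and> p < x}"

lemma finite_primes_below [simp]: "finite (primes_below x)"
  by (simp add: primes_below_def)

lemma primes_below_Suc:
  "primes_below (Suc x) = (if prime x then insert x (primes_below x) else primes_below x)"
  by (auto simp: primes_below_def less_Suc_eq)

lemma sum_primes_below_large:
  fixes x :: nat
  assumes "x > 512"
  shows "x + 6 \<le> \<Sum>(primes_below x)"
proof -
  obtain j where j: "2 ^ j < x" "x \<le> 2 ^ Suc j"
    using ex_power_ivl2[of 2 x] assms by auto
  have j9: "j \<ge> 9"
  proof (rule ccontr)
    assume "\<not> j \<ge> 9"
    then have "(2::nat) ^ Suc j \<le> 2 ^ 9" by (intro power_increasing) auto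
    with j assms show False by simp
  qed
  then have p512: "(2::nat) ^ j \<ge> 2 ^ 9" by (intro power_increasing) auto
  define P where "P = {p::nat. prime p \<and> p \<le> 2 ^ j}"
  obtain i where i: "j = Suc i" using j9 by (cases j) auto
  have "(2::nat) ^ (2 ^ j) = 4 ^ (2 ^ i)"
    by (simp add: i power_mult)
  also have "\<dots> \<le> (2 ^ j) ^ Suc (card P)"
    using four_power_le_power_card_primes[of "2 ^ i"] unfolding P_def i power_Suc[of 2 i] by simp
  also have "\<dots> = 2 ^ (j * Suc (card P))" by (simp only: power_mult)
  finally have "2 ^ j \<le> j * Suc (card P)"
    by (rule power_le_imp_le_exp[rotated]) simp
  then have "(2 ^ j)\<^sup>2 \<le> (j * Suc (card P))\<^sup>2"
    by (rule power_mono) simp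
  also have "\<dots> \<le> j\<^sup>2 * (2 * \<Sum>P + 1)"
    unfolding power_mult_distrib
    by (intro mult_le_mono2 power2_Suc_card_le_sum) (auto simp: P_def prime_ge_2_nat)
  finally have A: "(2 ^ j)\<^sup>2 \<le> j\<^sup>2 * (2 * \<Sum>P + 1)" .
  have "j\<^sup>2 * (6 * 2 ^ j) \<le> 2 ^ j * 2 ^ j"
    using six_mult_square_le_power2[OF j9] by (simp only: mult.assoc[symmetric] mult.commute[of _ 6]) simp
  also have "\<dots> \<le> j\<^sup>2 * (2 * \<Sum>P + 1)"
    using A by (simp add: power2_eq_square)
  finally have "6 * 2 ^ j \<le> 2 * \<Sum>P + 1"
    by (rule mult_left_le_imp_le) (use j9 in simp)
  \<comment> \<open>The sum is at least \<open>3 * 2 ^ j\<close> while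
    \<open>x \<le> 2 * 2 ^ j\<close>, a surplus of at least 512.\<close>
  then have "x + 6 \<le> \<Sum>P"
    using p512 j by simp
  also have "\<Sum>P \<le> \<Sum>(primes_below x)"
    using j by (intro sum_mono2) (auto simp: P_def primes_below_def)
  finally show ?thesis .
qed

lemma sum_le_sum_primes_below:
  assumes "\<forall>p\<in>A. prime p \<and> p < x"
  shows "\<Sum>A \<le> \<Sum>(primes_below x)"
  using assms by (intro sum_mono2) (auto simp: primes_below_def)

text \<open>The surplus 6 is chosen for \<open>two_subset_sum_below\<close>, where it keeps a
  remainder away from the exceptional value 2.\<close>

lemma sum_primes_below:
  fixes x :: nat
  assumes "x \<ge> 10"
  shows "x + 6 \<le> \<Sum>(primes_below x)"
proof -
  \<comment> \<open>In each bounded range the listed primes lie below \<open>x\<close> and sum to at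
    least the upper end plus 6.\<close>
  consider "x < 12" | "12 \<le> x" "x \<le> 22" | "22 < x" "x \<le> 70" | "70 < x" "x \<le> 512" | "x > 512"
    by linarith
  then show ?thesis
  proof cases
    case 1
    then show ?thesis using sum_le_sum_primes_below[of "{2,3,5,7}" x] assms by auto
  next
    case 2
    then show ?thesis using sum_le_sum_primes_below[of "{2,3,5,7,11}" x] by auto
  next
    case 3
    then show ?thesis using sum_le_sum_primes_below[of "{2,3,5,7,11,13,17,19}" x] by auto
  next
    case 4
    then show ?thesis
      using sum_le_sum_primes_below
        [of "{2,3,5,7,11,13,17,19,23,29,31,37,41,43,47,53,59,61,67}" x] by auto
  qed (rule sum_primes_below_large)
qed


section \<open>Subset sums of primes\<close>

lemma prime_le_sum_primes_below:
  fixes q :: nat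
  assumes "prime q" "q \<ge> 5"
  shows "q \<le> \<Sum>(primes_below q)"
proof (cases "q \<ge> 10")
  case True
  then show ?thesis using sum_primes_below[of q] by simp
next
  case False
  have "q \<noteq> 6" "q \<noteq> 8" "q \<noteq> 9" using assms(1) by auto
  with False assms consider "q = 5" | "q = 7" by linarith
  then show ?thesis
    using sum_le_sum_primes_below[of "{2,3}" q] sum_le_sum_primes_below[of "{2,3,5}" q]
    by cases auto
qed

lemma sum_primes_below_le_minus:
  "\<Sum>(primes_below x) \<le> \<Sum>(primes_below x - {p}) + p"
  by (cases "p \<in> primes_below x") (simp_all add: sum.remove)

text \<open>Greedy choice: a prime \<open>N \<le> n\<close> can be taken, leaving
  \<open>n - N\<close>. If \<open>n < N\<close> exceeds the sum of all smaller primes, taking all of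
  these misses \<open>n\<close> by less than \<open>p\<close>.\<close>

lemma odd_prime_subset_sum_below:
  fixes p :: nat
  assumes "prime p" "p \<noteq> 2" "n \<le> \<Sum>(primes_below N - {p})"
  shows "\<exists>A \<subseteq> primes_below N - {p}. \<Sum>A \<le> n \<and> n < \<Sum>A + p"
  using assms(3)
proof (induction N arbitrary: n)
  case 0
  then show ?case
    using prime_gt_0_nat[OF assms(1)] by (auto simp: primes_below_def)
next
  case (Suc N)
  let ?T = "primes_below N - {p}"
  show ?case
  proof (cases "prime N \<and> N \<noteq> p")
    case False
    then have "primes_below (Suc N) - {p} = ?T" by (auto simp: primes_below_Suc)
    then show ?thesis using Suc by simp
  next
    case True
    then have T: "primes_below (Suc N) - {p} = insert N ?T" by (auto simp: primes_below_Suc)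
    have N: "N \<notin> ?T" by (simp add: primes_below_def)
    consider "n \<le> \<Sum>?T" | "\<Sum>?T < n" "n < N" | "n \<ge> N" by linarith
    then show ?thesis
    proof cases
      case 1
      then show ?thesis using Suc.IH[of n] unfolding T by blast
    next
      case 2
      have "N \<le> \<Sum>?T + p"
      proof (cases "N < p")
        case False
        have "p \<ge> 3" using assms prime_ge_2_nat[of p] by linarith
        moreover have "N \<noteq> 4" using True by auto
        ultimately have "N \<ge> 5" using False True by linarith
        then have "N \<le> \<Sum>(primes_below N)" using True prime_le_sum_primes_below by blast
        then show ?thesis using sum_primes_below_le_minus[of N p] by linarith
      qed simp
      with 2 show ?thesis unfolding T by (intro exI[of _ ?T]) auto
    next
      case 3
      have "n - N \<le> \<Sum>?T" using Suc.prems N unfolding T by simp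
      from Suc.IH[OF this] obtain A where A: "A \<subseteq> ?T" "\<Sum>A \<le> n - N" "n - N < \<Sum>A + p"
        by blast
      have "finite A" "N \<notin> A" using A(1) N finite_subset[OF A(1)] by auto
      then show ?thesis
        using A 3 unfolding T by (intro exI[of _ "insert N A"]) auto
    qed
  qed
qed

text \<open>For the window \<open>{n - 1, n}\<close> both \<open>n = 2\<close> and, by complementation, \<open>n = S - 1\<close> fail,
  where \<open>S\<close> is the sum of all admissible primes.\<close>

lemma two_subset_sum_below:
  assumes "N \<ge> 8" "n \<noteq> 2" "n + 2 \<le> \<Sum>(primes_below N - {2})"
  shows "\<exists>A \<subseteq> primes_below N - {2}. \<Sum>A \<le> n \<and> n < \<Sum>A + 2"
  using assms
proof (induction N arbitrary: n rule: dec_induct)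
  case base
  have "q \<in> {2,3,5,7}" if "prime q" "q < 8" for q :: nat
  proof -
    have "q \<noteq> 0" "q \<noteq> 1" "q \<noteq> 4" "q \<noteq> 6" using that(1) by auto
    with that(2) show ?thesis by simp presburger
  qed
  then have "primes_below 8 = {2,3,5,7}"
    by (auto simp: primes_below_def)
  then have T: "primes_below 8 - {2} = {3,5,7}" by auto
  have "n \<le> 13" using base.prems unfolding T by simp
  \<comment> \<open>The subset sums 0, 3, 5, 7, 8, 10, 12 meet every window
    \<open>{n - 1, n}\<close> with \<open>n \<le> 13\<close> except that of
    \<open>n = 2\<close>.\<close>
  with base.prems(1) consider "n \<le> 1" | "3 \<le> n" "n \<le> 4" | "5 \<le> n" "n \<le> 6" | "n = 7"
    | "8 \<le> n" "n \<le> 9" | "10 \<le> n" "n \<le> 11" | "12 \<le> n" by linarith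
  then show ?case
  proof cases
    case 1 then show ?thesis unfolding T by (intro exI[of _ "{}"]) auto
  next
    case 2 then show ?thesis unfolding T by (intro exI[of _ "{3}"]) auto
  next
    case 3 then show ?thesis unfolding T by (intro exI[of _ "{5}"]) auto
  next
    case 4 then show ?thesis unfolding T by (intro exI[of _ "{7}"]) auto
  next
    case 5 then show ?thesis unfolding T by (intro exI[of _ "{3,5}"]) auto
  next
    case 6 then show ?thesis unfolding T by (intro exI[of _ "{3,7}"]) auto
  next
    case 7 then show ?thesis using \<open>n \<le> 13\<close> unfolding T by (intro exI[of _ "{5,7}"]) auto
  qed
next
  case (step N)
  let ?T = "primes_below N - {2}"
  show ?case
  proof (cases "prime N")
    case False
    then have "primes_below (Suc N) - {2} = ?T" by (auto simp: primes_below_Suc)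
    then show ?thesis using step by simp
  next
    case True
    have T: "primes_below (Suc N) - {2} = insert N ?T"
      using True step.hyps by (auto simp: primes_below_Suc)
    have N: "N \<notin> ?T" by (simp add: primes_below_def)
    show ?thesis
    proof (cases "n + 2 \<le> \<Sum>?T")
      case True
      then show ?thesis using step.IH[of n] step.prems unfolding T by blast
    next
      case False
      have "N \<noteq> 8" "N \<noteq> 9" using True by auto
      then have "N + 6 \<le> \<Sum>(primes_below N)" using step.hyps by (intro sum_primes_below) auto
      \<comment> \<open>Dropping 2 leaves a sum of at least \<open>N + 4\<close>, which is below
        \<open>n + 2\<close>; so \<open>N\<close> can be taken and \<open>n - N \<ge> 3\<close>
        avoids the exception.\<close>
      then have le: "N + 3 \<le> n" using False sum_primes_below_le_minus[of N 2] by linarith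
      have "n - N + 2 \<le> \<Sum>?T" using step.prems N le unfolding T by simp
      moreover have "n - N \<noteq> 2" using le by simp
      ultimately obtain A where A: "A \<subseteq> ?T" "\<Sum>A \<le> n - N" "n - N < \<Sum>A + 2"
        using step.IH by blast
      have "finite A" "N \<notin> A" using A(1) N finite_subset[OF A(1)] by auto
      then show ?thesis
        using A le unfolding T by (intro exI[of _ "insert N A"]) auto
    qed
  qed
qed

lemma ex_distinct_primes_sum:
  fixes n p :: nat
  assumes "prime p" "n \<noteq> 2"
  obtains A where "finite A" "\<forall>q\<in>A. prime q" "p \<notin> A" "\<Sum>A \<le> n" "n < \<Sum>A + p"
proof -
  let ?N = "n + p + 10"
  have "n + 2 \<le> \<Sum>(primes_below ?N - {p})"
    using sum_primes_below[of ?N] sum_primes_below_le_minus[of ?N p] by linarith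
  then obtain A where "A \<subseteq> primes_below ?N - {p}" "\<Sum>A \<le> n" "n < \<Sum>A + p"
    using odd_prime_subset_sum_below[OF assms(1), of n ?N] two_subset_sum_below[of ?N n] assms
    by (cases "p = 2") auto
  moreover from this(1) have "finite A" by (rule finite_subset) simp
  ultimately show thesis
    by (intro that[of A]) (auto simp: primes_below_def)
qed

section \<open>Orders of permutations\<close>

lemma sum_le_prod_nat:
  fixes A :: "nat set"
  assumes "finite A" "\<And>a. a \<in> A \<Longrightarrow> a \<ge> 2"
  shows "\<Sum>A \<le> \<Prod>A"
  using assms
proof (induction rule: finite_induct)
  case (insert a A)
  show ?case
  proof (cases "A = {}")
    case False
    then obtain b where "b \<in> A" by blast
    then have "2 \<le> \<Sum>A"
      using insert.prems[of b] insert.hyps(1) member_le_sum[of b A "\<lambda>x. x"] by simp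
    moreover have "\<Sum>A \<le> \<Prod>A" using insert by simp
    ultimately have "a * 2 \<le> a * \<Prod>A" "2 * \<Prod>A \<le> a * \<Prod>A"
      using insert.prems[of a] by (auto intro: mult_le_mono)
    with \<open>\<Sum>A \<le> \<Prod>A\<close> have "a + \<Sum>A \<le> a * \<Prod>A" by linarith
    then show ?thesis using insert.hyps by simp
  qed simp
qed simp

lemma prod_primes_dvd_nat:
  fixes A :: "nat set"
  assumes "finite A" "\<And>q. q \<in> A \<Longrightarrow> prime q" "\<And>q. q \<in> A \<Longrightarrow> q dvd m"
  shows "\<Prod>A dvd m"
  using assms
proof (induction rule: finite_induct)
  case (insert q A)
  have "coprime q (\<Prod>A)"
    using insert by (intro prod_coprime_right) (auto intro: primes_coprime)
  then show ?case using insert by (simp add: divides_mult)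
qed simp

text \<open>The primes dividing one cycle length multiply to at most that length, hence also sum to at
  most it.\<close>

lemma sum_primes_dvd_order_le_card:
  fixes B :: "nat set"
  assumes "f permutes S" "finite S" "finite B"
    and prime: "\<And>q. q \<in> B \<Longrightarrow> prime q"
    and dvd: "\<And>q k. q \<in> B \<Longrightarrow> f ^^ k = id \<Longrightarrow> q dvd k"
  shows "\<Sum>B \<le> card S"
proof -
  have perm: "permutation f" using assms permutation_permutes by blast
  have fix_outside: "(f ^^ k) x = x" if "x \<notin> S" for k x
    using permutes_funpow[OF assms(1)] that by (rule permutes_not_in)
  \<comment> \<open>This product is a multiple of every cycle length, so each prime in
    \<open>B\<close> divides it and hence divides some cycle length.\<close>
  have "f ^^ (\<Prod>x\<in>S. least_power f x) = id"
  proof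
    fix x
    show "(f ^^ (\<Prod>x\<in>S. least_power f x)) x = id x"
    proof (cases "x \<in> S")
      case True
      then have "least_power f x dvd (\<Prod>x\<in>S. least_power f x)"
        using assms(2) by (rule dvd_prodI[rotated])
      then show ?thesis using least_power_dvd[OF perm] by simp
    qed (simp add: fix_outside)
  qed
  then have "\<exists>x\<in>S. q dvd least_power f x" if "q \<in> B" for q
    using dvd[OF that] prime_dvd_prod_iff[OF assms(2) prime[OF that]] by blast
  then obtain g where g: "\<And>q. q \<in> B \<Longrightarrow> g q \<in> S \<and> q dvd least_power f (g q)"
    by metis
  define orb where "orb q = set (support f (g q))" for q
  have card_orb: "card (orb q) = least_power f (g q)" for q
    using distinct_card[OF cycle_of_permutation[OF perm, of "g q"]] by (simp add: orb_def)
  have orb_S: "orb q \<subseteq> S" if "q \<in> B" for q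
    using g[OF that] permutes_in_image[OF permutes_funpow[OF assms(1)]]
    by (auto simp: orb_def)
  have le: "\<Sum>{q \<in> B. orb q = Q} \<le> card Q" if "Q \<in> orb ` B" for Q
  proof -
    have "\<Sum>{q \<in> B. orb q = Q} \<le> \<Prod>{q \<in> B. orb q = Q}"
      using assms(3) prime prime_ge_2_nat by (intro sum_le_prod_nat) auto
    also have "\<Prod>{q \<in> B. orb q = Q} dvd card Q"
      using assms(3) prime g card_orb by (intro prod_primes_dvd_nat) auto
    then have "\<Prod>{q \<in> B. orb q = Q} \<le> card Q"
      using that card_orb least_power_of_permutation(2)[OF perm] by (intro dvd_imp_le) auto
    finally show ?thesis .
  qed
  \<comment> \<open>The primes are grouped by the cycle assigned to them; distinct cycles are
    disjoint.\<close>
  have "\<Sum>B = (\<Sum>Q\<in>orb ` B. \<Sum>{q \<in> B. orb q = Q})"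
    using assms(3) by (rule sum.image_gen)
  also have "\<dots> \<le> (\<Sum>Q\<in>orb ` B. card Q)"
    by (rule sum_mono) (rule le)
  also have "\<dots> = card (\<Union>(orb ` B))"
    using disjoint_support[OF perm]
    by (intro card_Union_disjoint[symmetric]) (auto simp: orb_def disjoint_def pairwise_def disjnt_def)
  also have "\<dots> \<le> card S"
    using orb_S assms(2) by (intro card_mono) auto
  finally show ?thesis .
qed

text \<open>Raising the product to \<open>?d * ord y\<close> kills the part of \<open>y\<close>, so
  \<open>ord x\<close> divides \<open>?d * ord y\<close> and by coprimality \<open>?d\<close>;
  likewise for \<open>ord y\<close>.\<close>

lemma (in group) ord_mult_coprime:
  assumes "x \<in> carrier G" "y \<in> carrier G" "x \<otimes> y = y \<otimes> x" "coprime (ord x) (ord y)"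
  shows "ord (x \<otimes> y) = ord x * ord y"
proof (rule dvd_antisym)
  let ?d = "ord (x \<otimes> y)"
  have pow: "x [^] (?d * k) \<otimes> y [^] (?d * k) = \<one>" for k
    using assms by (simp add: pow_eq_id flip: pow_mult_distrib)
  have "x [^] (?d * ord y) = \<one>"
    using pow[of "ord y"] assms(1,2) pow_eq_id[of y "?d * ord y"] by simp
  then have "ord x dvd ?d"
    using assms by (simp add: pow_eq_id coprime_dvd_mult_left_iff)
  moreover have "y [^] (?d * ord x) = \<one>"
    using pow[of "ord x"] assms(1,2) pow_eq_id[of x "?d * ord x"] by simp
  then have "ord y dvd ?d"
    using assms by (simp add: pow_eq_id coprime_dvd_mult_left_iff coprime_commute)
  ultimately show "ord x * ord y dvd ?d"
    using assms(4) by (rule divides_mult)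
qed (use assms ord_mul_divides in blast)

section \<open>Orders in the symmetric group\<close>

lemma sym_group_nat_pow: "f [^]\<^bsub>sym_group n\<^esub> (k::nat) = f ^^ k"
  by (induction k) (simp_all add: sym_group_one sym_group_mult funpow_Suc_right del: funpow.simps(2))

lemma finite_carrier_sym_group: "finite (carrier (sym_group n))"
  by (simp add: sym_group_def finite_permutations)

text \<open>The order divides a prime, so only order 1 must be excluded; it would make the list
  equal to its rotation, against distinctness.\<close>

lemma ord_cycle_of_list:
  assumes "distinct cs" "set cs \<subseteq> {1..n}" "prime (length cs)"
  shows "group.ord (sym_group n) (cycle_of_list cs) = length cs"
proof -
  interpret group "sym_group n" by (rule sym_group_is_group)
  let ?c = "cycle_of_list cs"
  have c: "?c \<in> carrier (sym_group n)"
    using permutes_subset[OF cycle_permutes assms(2)] by (simp add: sym_group_carrier)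
  have "ord ?c dvd length cs"
    using c cycle_is_id_root[OF assms(1)]
    by (simp add: sym_group_one sym_group_nat_pow flip: pow_eq_id)
  moreover have "ord ?c \<noteq> 1"
  proof
    assume "ord ?c = 1"
    then have "rotate1 cs = cs"
      using cyclic_rotation[OF assms(1), of 1] ord_eq_1[OF c] by (simp add: sym_group_one)
    moreover have len: "length cs \<ge> 2" using assms(3) by (rule prime_ge_2_nat)
    moreover from len have ne: "cs \<noteq> []" by auto
    ultimately have "cs ! 0 = cs ! 1"
      using nth_rotate1[of 0 cs] by simp
    with len ne nth_eq_iff_index_eq[OF assms(1), of 0 1] show False by simp
  qed
  ultimately show ?thesis using assms(3) by (auto simp: prime_nat_iff)
qed

lemma permutes_disjoint_commute:
  assumes "f permutes S" "g permutes T" "S \<inter> T = {}"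
  shows "f \<circ> g = g \<circ> f"
proof
  fix x
  have "f x \<in> S \<longleftrightarrow> x \<in> S" "g x \<in> T \<longleftrightarrow> x \<in> T"
    using assms by (simp_all add: permutes_in_image)
  moreover have "y \<notin> S \<Longrightarrow> f y = y" "y \<notin> T \<Longrightarrow> g y = y" for y
    using assms by (simp_all add: permutes_not_in)
  ultimately show "(f \<circ> g) x = (g \<circ> f) x"
    using assms(3) by (metis comp_apply disjoint_iff)
qed

text \<open>The support is part of the claim so that the induction can place the next cycle on the
  fresh points after \<open>\<Sum>A\<close>.\<close>

lemma ex_permutation_ord_prod_primes:
  assumes "finite A" "\<forall>q\<in>A. prime q" "\<Sum>A \<le> n"
  shows "\<exists>f. f permutes {1..\<Sum>A} \<and> group.ord (sym_group n) f = \<Prod>A"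
  using assms
proof (induction rule: finite_induct)
  case empty
  interpret group "sym_group n" by (rule sym_group_is_group)
  have "ord id = 1" using ord_id unfolding sym_group_one .
  then show ?case by (metis permutes_id prod.empty)
next
  case (insert q A)
  interpret group "sym_group n" by (rule sym_group_is_group)
  obtain f where f: "f permutes {1..\<Sum>A}" "ord f = \<Prod>A" using insert by auto
  define cs where "cs = [\<Sum>A + 1..<\<Sum>A + q + 1]"
  have cs: "distinct cs" "set cs = {\<Sum>A + 1..\<Sum>A + q}" "length cs = q"
    by (auto simp: cs_def)
  have sum: "\<Sum>(insert q A) = \<Sum>A + q" using insert.hyps by simp
  have c: "cycle_of_list cs permutes {\<Sum>A + 1..\<Sum>A + q}"
    using cycle_permutes[of cs] cs(2) by simp
  have ord_c: "ord (cycle_of_list cs) = q"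
    using ord_cycle_of_list[of cs n] cs insert.prems sum by auto
  have "f \<circ> cycle_of_list cs = cycle_of_list cs \<circ> f"
    using f(1) c by (rule permutes_disjoint_commute) auto
  moreover have "coprime (\<Prod>A) q"
    using insert by (intro prod_coprime_left) (auto intro: primes_coprime)
  moreover have "f \<in> carrier (sym_group n)" "cycle_of_list cs \<in> carrier (sym_group n)"
    using permutes_subset[OF f(1), of "{1..n}"] permutes_subset[OF c, of "{1..n}"] insert.prems sum
    by (auto simp: sym_group_carrier)
  ultimately have "ord (f \<circ> cycle_of_list cs) = \<Prod>(insert q A)"
    using ord_mult_coprime[of f "cycle_of_list cs"] f(2) ord_c insert.hyps
    by (simp add: sym_group_mult mult.commute)
  moreover have "f \<circ> cycle_of_list cs permutes {1..\<Sum>A + q}"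
    using permutes_subset[OF f(1), of "{1..\<Sum>A + q}"] permutes_subset[OF c, of "{1..\<Sum>A + q}"]
    by (intro permutes_compose) auto
  ultimately show ?case unfolding sum by blast
qed

text \<open>A power \<open>x\<close> of \<open>g\<close> has order \<open>p\<close> and commutes
  with \<open>h\<close>. By coprimality \<open>h \<circ> x\<close> has order
  \<open>\<Prod>A * p\<close>, and all these primes must fit into \<open>n\<close> points.\<close>

lemma commuting_sum_le:
  assumes "g \<in> carrier (sym_group n)" "h \<in> carrier (sym_group n)" "g \<circ> h = h \<circ> g"
    and A: "finite A" "\<forall>q\<in>A. prime q" "group.ord (sym_group n) h = \<Prod>A"
    and p: "prime p" "p \<notin> A" "p dvd group.ord (sym_group n) g"
  shows "\<Sum>A + p \<le> n"
proof -
  interpret group "sym_group n" by (rule sym_group_is_group)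
  define k where "k = ord g div p"
  define x where "x = g [^]\<^bsub>sym_group n\<^esub> k"
  have "ord g \<noteq> 0"
    using ord_ge_1[OF finite_carrier_sym_group assms(1)] by simp
  then have k: "ord g = k * p" "k \<noteq> 0" using p(3) by (auto simp: k_def)
  have x: "x \<in> carrier (sym_group n)" "ord x = p"
    using assms(1) k by (simp_all add: x_def ord_pow)
  have "h \<otimes>\<^bsub>sym_group n\<^esub> x = x \<otimes>\<^bsub>sym_group n\<^esub> h"
    unfolding x_def using assms(1-3) by (intro group_commutes_pow[symmetric]) (simp_all add: sym_group_mult)
  moreover have "coprime (\<Prod>A) p"
    using A p by (intro prod_coprime_left) (auto intro: primes_coprime)
  ultimately have "ord (h \<circ> x) = \<Prod>A * p"
    using ord_mult_coprime[of h x] assms(2) x A(3) by (simp add: sym_group_mult)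
  moreover have hx: "h \<circ> x \<in> carrier (sym_group n)"
    using m_closed[OF assms(2) x(1)] by (simp add: sym_group_mult)
  ultimately have dvd: "\<Prod>A * p dvd k" if "(h \<circ> x) ^^ k = id" for k
    using pow_eq_id[OF hx, of k] that by (simp add: sym_group_one sym_group_nat_pow)
  have "\<Sum>(insert p A) \<le> card {1..n}"
  proof (rule sum_primes_dvd_order_le_card)
    show "h \<circ> x permutes {1..n}" using hx by (simp add: sym_group_carrier)
    fix q k assume "q \<in> insert p A" "(h \<circ> x) ^^ k = id"
    then show "q dvd k"
      using dvd[of k] dvd_prodI[OF A(1), of q "\<lambda>x. x"]
      by (auto intro: dvd_trans dvd_mult_left dvd_mult_right)
  qed (use A p in auto)
  then show ?thesis using A(1) p(2) by simp
qed

section \<open>Dominant vertices of the graph\<close>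

theorem theorem4p6:
  fixes n :: nat
  assumes "n \<ge> 4"
  shows "{v. dominant_vertex (with_proj (order_super_commuting_graph (sym_group n))) v}
           = {\<one>\<^bsub>sym_group n\<^esub>}"
proof -
  interpret group "sym_group n" by (rule sym_group_is_group)
  have iff: "dominant_vertex (with_proj (order_super_commuting_graph (sym_group n))) v \<longleftrightarrow>
      v \<in> carrier (sym_group n) \<and> (\<forall>u\<in>carrier (sym_group n). u \<noteq> v \<longrightarrow> ord v = ord u \<or>
        (\<exists>g\<in>carrier (sym_group n). \<exists>h\<in>carrier (sym_group n).
          ord g = ord v \<and> ord h = ord u \<and> g \<noteq> h \<and> g \<circ> h = h \<circ> g))" for v
    by (auto simp: dominant_vertex_def order_super_commuting_graph_def sym_group_mult)
  have "v = \<one>\<^bsub>sym_group n\<^esub>"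
    if dom: "dominant_vertex (with_proj (order_super_commuting_graph (sym_group n))) v" for v
  proof (rule ccontr)
    assume "v \<noteq> \<one>\<^bsub>sym_group n\<^esub>"
    moreover have v: "v \<in> carrier (sym_group n)" using dom iff by blast
    ultimately obtain p where p: "prime p" "p dvd ord v"
      using ord_eq_1 prime_factor_nat by blast
    \<comment> \<open>The exception \<open>n = 2\<close> is excluded by
      \<open>n \<ge> 4\<close>.\<close>
    obtain A where A: "finite A" "\<forall>q\<in>A. prime q" "p \<notin> A" "\<Sum>A \<le> n" "n < \<Sum>A + p"
      using ex_distinct_primes_sum[OF p(1), of n] assms by auto
    obtain u where u: "u permutes {1..\<Sum>A}" "ord u = \<Prod>A"
      using ex_permutation_ord_prod_primes[OF A(1,2,4)] by blast
    have u_carrier: "u \<in> carrier (sym_group n)"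
      using permutes_subset[OF u(1), of "{1..n}"] A(4) by (simp add: sym_group_carrier)
    have "\<not> p dvd ord u"
      using A(1-3) p(1) u(2) prime_dvd_prod_iff[OF A(1) p(1), of "\<lambda>x. x"]
      by (auto dest: primes_dvd_imp_eq)
    \<comment> \<open>The orders differ, so adjacency can only come from a commuting pair.\<close>
    with p(2) have "ord v \<noteq> ord u" "u \<noteq> v" by auto
    then obtain g h where "g \<in> carrier (sym_group n)" "h \<in> carrier (sym_group n)"
      "ord g = ord v" "ord h = \<Prod>A" "g \<circ> h = h \<circ> g"
      using dom u_carrier u(2) unfolding iff by metis
    from commuting_sum_le[OF this(1,2,5) A(1,2) this(4) p(1) A(3)] this(3) p(2) A(5)
    show False by simp
  qed
  moreover have "dominant_vertex (with_proj (order_super_commuting_graph (sym_group n)))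
      \<one>\<^bsub>sym_group n\<^esub>"
    unfolding iff
  proof (intro conjI ballI impI disjI2)
    fix u assume u: "u \<in> carrier (sym_group n)" "u \<noteq> \<one>\<^bsub>sym_group n\<^esub>"
    \<comment> \<open>The witnesses are the identity and \<open>u\<close> itself.\<close>
    show "\<exists>g\<in>carrier (sym_group n). \<exists>h\<in>carrier (sym_group n).
        ord g = ord \<one>\<^bsub>sym_group n\<^esub> \<and> ord h = ord u \<and> g \<noteq> h \<and> g \<circ> h = h \<circ> g"
      by (rule bexI[OF bexI[OF _ u(1)] one_closed]) (use u in \<open>auto simp: sym_group_one\<close>)
  qed simp
  ultimately show ?thesis by blast
qed

end
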